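(* Let $n\ge 3$. When the recursive procedure $\mathrm{Construct}$ described in the context is applied to a cycle on $n$ vertices, it outputs exactly one representative of every isomorphism class of uniquely hamiltonian graphs of order $n$.
   Context: Graphs are finite and simple. A graph is uniquely hamiltonian if it contains exactly one hamiltonian cycle (cycles are regarded as subgraphs). An edge $e$ of a uniquely hamiltonian graph $G$ is reducible if $G-e$ (remove the edge $e$, keep its endpoints) is still uniquely hamiltonian; equivalently, $e$ does not lie on the hamiltonian cycle $\mathfrak{h}$ of $G$. To each reducible edge $e=ab$ of $G$ assign the 9-tuple $(x_0,\dots,x_8)$ where: - $x_0$ (respectively $x_1$) is the maximum (respectively minimum) of the degrees of $a$ and $b$; - $x_2$ is the negative of the minimum length between $a$ and $b$ on $\mathfrak{h}$; - let $\sigma(a)$ be the sum of the degrees of the two vertices preceding and succeeding $a$ on $\mathfrak{h}$, and define $\sigma(b)$ likewise; $x_3$ (respectively $x_4$) is the negative of the maximum (respectively minimum) of $\sigma(a)$ and $\sigma(b)$; - $x_5$ is the number of common neighbours of $a$ and $b$; - $x_6$ is the negative of the number of vertices at distance at most $2$ of $a$ and $b$; - $\{x_7,x_8\}$ is the lexicographically largest label, in a canonical labelling of $G$, of an edge in the same orbit as $e$ under the automorphism group of $G$. Here a canonical labelling is a labelling of the vertices by $1,\dots,n$ produced by a fixed procedure such that isomorphic graphs yield identical labelled graphs; the label of an edge is the pair of labels of its endpoints, written as an ordered pair by a fixed convention (say, larger label first). A canonical edge of $G$ is a reducible edge whose 9-tuple is lexicographically maximal among all reducible edges of $G$. The insertion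 of an edge $ab$ between two non-adjacent vertices of $G$, giving the uniquely hamiltonian graph $G+ab$, is called a canonical expansion if $ab$ is a canonical edge of $G+ab$. Procedure $\mathrm{Construct}(G)$: 1. Output $G$. 2. Determine the list $L$ of all pairs of non-adjacent vertices of $G$, and the orbits of $L$ under the automorphism group of $G$. 3. For one representative pair $\{a,b\}$ from every orbit of $L$: add the edge $ab$ to $G$; if the resulting graph is still uniquely hamiltonian and this expansion was canonical, call $\mathrm{Construct}$ on the resulting graph; then remove the edge $ab$ again. *)

theory Defs
  imports "HOL-Library.Extended_Nat" "HOL-Library.Product_Lexorder"
begin

datatype 'a graph = Graph (verts: "'a set") (edges: "'a set set")

definition simple_graph :: "'a graph \<Rightarrow> bool" where
  "simple_graph G \<longleftrightarrow> finite (verts G) \<and>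
     edges G \<subseteq> {{a, b} | a b. a \<in> verts G \<and> b \<in> verts G \<and> a \<noteq> b}"

definition subgraph :: "'a graph \<Rightarrow> 'a graph \<Rightarrow> bool" where
  "subgraph H G \<longleftrightarrow> verts H \<subseteq> verts G \<and> edges H \<subseteq> edges G"

definition add_edge :: "'a graph \<Rightarrow> 'a set \<Rightarrow> 'a graph" where
  "add_edge G e = Graph (verts G) (insert e (edges G))"

definition remove_edge :: "'a graph \<Rightarrow> 'a set \<Rightarrow> 'a graph" where
  "remove_edge G e = Graph (verts G) (edges G - {e})"

definition neighbours :: "'a graph \<Rightarrow> 'a \<Rightarrow> 'a set" where
  "neighbours G v = {w \<in> verts G. {v, w} \<in> edges G}"

definition degree :: "'a graph \<Rightarrow> 'a \<Rightarrow> nat" where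
  "degree G v = card (neighbours G v)"

definition path_between :: "'a graph \<Rightarrow> 'a \<Rightarrow> 'a list \<Rightarrow> 'a \<Rightarrow> bool" where
  "path_between G u p v \<longleftrightarrow> p \<noteq> [] \<and> hd p = u \<and> last p = v \<and> distinct p \<and>
     set p \<subseteq> verts G \<and> successively (\<lambda>x y. {x, y} \<in> edges G) p"

definition distance :: "'a graph \<Rightarrow> 'a \<Rightarrow> 'a \<Rightarrow> enat" where
  "distance G u v = (INF p \<in> {p. path_between G u p v}. enat (length p - 1))"


definition graph_iso :: "('a \<Rightarrow> 'b) \<Rightarrow> 'a graph \<Rightarrow> 'b graph \<Rightarrow> bool" where
  "graph_iso f G H \<longleftrightarrow> bij_betw f (verts G) (verts H) \<and>
     (\<forall>u \<in> verts G. \<forall>v \<in> verts G. {u, v} \<in> edges G \<longleftrightarrow> {f u, f v} \<in> edges H)"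

definition isomorphic :: "'a graph \<Rightarrow> 'b graph \<Rightarrow> bool" where
  "isomorphic G H \<longleftrightarrow> (\<exists>f. graph_iso f G H)"

text \<open>The orbit, under the automorphism group of \<open>G\<close>, of an unordered pair of vertices
  (adjacent or not).\<close>

definition pair_orbit :: "'a graph \<Rightarrow> 'a set \<Rightarrow> 'a set set" where
  "pair_orbit G e = {f ` e | f. graph_iso f G G}"


definition is_cycle :: "'a graph \<Rightarrow> bool" where
  "is_cycle C \<longleftrightarrow> (\<exists>vs. 3 \<le> length vs \<and> distinct vs \<and> verts C = set vs \<and>
     edges C = {{vs ! i, vs ! (Suc i mod length vs)} | i. i < length vs})"

definition hamiltonian_cycle :: "'a graph \<Rightarrow> 'a graph \<Rightarrow> bool" where
  "hamiltonian_cycle C G \<longleftrightarrow> is_cycle C \<and> subgraph C G \<and> verts C = verts G"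

definition uniquely_hamiltonian :: "'a graph \<Rightarrow> bool" where
  "uniquely_hamiltonian G \<longleftrightarrow> simple_graph G \<and> (\<exists>!C. hamiltonian_cycle C G)"

definition ham_cycle :: "'a graph \<Rightarrow> 'a graph" where
  "ham_cycle G = (THE C. hamiltonian_cycle C G)"

definition reducible :: "'a graph \<Rightarrow> 'a set \<Rightarrow> bool" where
  "reducible G e \<longleftrightarrow> uniquely_hamiltonian G \<and> e \<in> edges G \<and>
     uniquely_hamiltonian (remove_edge G e)"


text \<open>\<open>lab G v\<close> is the label that the labelling procedure \<open>lab\<close> gives to the vertex \<open>v\<close>
  of \<open>G\<close>. The label set is determined by the order of the graph, so two labelled graphs of the
  same order are identical iff their relabelled edge sets coincide.\<close>

definition canonical_labelling :: "('a graph \<Rightarrow> 'a \<Rightarrow> nat) \<Rightarrow> bool" where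
  "canonical_labelling lab \<longleftrightarrow>
     (\<forall>G. simple_graph G \<longrightarrow> bij_betw (lab G) (verts G) {1..card (verts G)}) \<and>
     (\<forall>G H. simple_graph G \<and> simple_graph H \<and> isomorphic G H \<longrightarrow>
        (`) (lab G) ` edges G = (`) (lab H) ` edges H)"

definition edge_label :: "('a graph \<Rightarrow> 'a \<Rightarrow> nat) \<Rightarrow> 'a graph \<Rightarrow> 'a set \<Rightarrow> nat \<times> nat" where
  "edge_label lab G e = (Max (lab G ` e), Min (lab G ` e))"

definition sigma :: "'a graph \<Rightarrow> 'a \<Rightarrow> nat" where
  "sigma G v = (\<Sum>w \<in> neighbours (ham_cycle G) v. degree G w)"

text \<open>All comparisons of tuples, including \<open>Max\<close> over edge labels, are lexicographic
  (\<open>HOL-Library.Product_Lexorder\<close>); the last component is the pair \<open>(x\<^sub>7, x\<^sub>8)\<close>.\<close>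

type_synonym nine_tuple = "int \<times> int \<times> int \<times> int \<times> int \<times> int \<times> int \<times> nat \<times> nat"

definition edge_tuple ::
  "('a graph \<Rightarrow> 'a \<Rightarrow> nat) \<Rightarrow> 'a graph \<Rightarrow> 'a \<Rightarrow> 'a \<Rightarrow> nine_tuple" where
  "edge_tuple lab G a b =
    (int (max (degree G a) (degree G b)),
     int (min (degree G a) (degree G b)),
     - int (the_enat (distance (ham_cycle G) a b)),
     - int (max (sigma G a) (sigma G b)),
     - int (min (sigma G a) (sigma G b)),
     int (card (neighbours G a \<inter> neighbours G b)),
     - int (card {v \<in> verts G. distance G a v \<le> 2 \<and> distance G b v \<le> 2}),
     Max (edge_label lab G ` pair_orbit G {a, b}))"

definition canonical_edge :: "('a graph \<Rightarrow> 'a \<Rightarrow> nat) \<Rightarrow> 'a graph \<Rightarrow> 'a \<Rightarrow> 'a \<Rightarrow> bool" where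
  "canonical_edge lab G a b \<longleftrightarrow> reducible G {a, b} \<and>
     (\<forall>c d. reducible G {c, d} \<longrightarrow> edge_tuple lab G c d \<le> edge_tuple lab G a b)"


definition nonadjacent_pairs :: "'a graph \<Rightarrow> 'a set set" where
  "nonadjacent_pairs G =
     {{a, b} | a b. a \<in> verts G \<and> b \<in> verts G \<and> a \<noteq> b \<and> {a, b} \<notin> edges G}"

definition canonical_expansion ::
  "('a graph \<Rightarrow> 'a \<Rightarrow> nat) \<Rightarrow> 'a graph \<Rightarrow> 'a \<Rightarrow> 'a \<Rightarrow> bool" where
  "canonical_expansion lab G a b \<longleftrightarrow> {a, b} \<in> nonadjacent_pairs G \<and>
     uniquely_hamiltonian (add_edge G {a, b}) \<and> canonical_edge lab (add_edge G {a, b}) a b"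

definition orbit_representatives :: "'a graph \<Rightarrow> ('a \<times> 'a) list \<Rightarrow> bool" where
  "orbit_representatives G ps \<longleftrightarrow> distinct ps \<and>
     (\<forall>(a, b) \<in> set ps. {a, b} \<in> nonadjacent_pairs G) \<and>
     (\<forall>orb \<in> pair_orbit G ` nonadjacent_pairs G. \<exists>!(a, b). (a, b) \<in> set ps \<and> {a, b} \<in> orb)"

text \<open>The procedure is nondeterministic in the choice and the order of the orbit representatives.
  \<open>construct lab G out\<close> says that some execution of the procedure on \<open>G\<close> outputs the sequence
  \<open>out\<close>; \<open>process lab G ps out\<close> says the same for the loop, run on the representatives \<open>ps\<close>.
  Every recursive call adds an edge, so all executions on finite graphs terminate.\<close>

inductive construct :: "('a graph \<Rightarrow> 'a \<Rightarrow> nat) \<Rightarrow> 'a graph \<Rightarrow> 'a graph list \<Rightarrow> bool"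
  and process ::
    "('a graph \<Rightarrow> 'a \<Rightarrow> nat) \<Rightarrow> 'a graph \<Rightarrow> ('a \<times> 'a) list \<Rightarrow> 'a graph list \<Rightarrow> bool"
  for lab :: "'a graph \<Rightarrow> 'a \<Rightarrow> nat"
where
  construct:
    "orbit_representatives G ps \<Longrightarrow> process lab G ps out \<Longrightarrow> construct lab G (G # out)"
| process_done:
    "process lab G [] []"
| process_call:
    "uniquely_hamiltonian (add_edge G {a, b}) \<Longrightarrow> canonical_expansion lab G a b \<Longrightarrow>
     construct lab (add_edge G {a, b}) out \<Longrightarrow> process lab G ps out' \<Longrightarrow>
     process lab G ((a, b) # ps) (out @ out')"
| process_skip:
    "\<not> (uniquely_hamiltonian (add_edge G {a, b}) \<and> canonical_expansion lab G a b) \<Longrightarrow>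
     process lab G ps out \<Longrightarrow> process lab G ((a, b) # ps) out"

end

theory Submission
  imports Defs
begin

text \<open>The argument is McKay's canonical construction path method.  Every uniquely hamiltonian graph
  \<open>H\<close> other than a cycle has reducible edges, namely those off its hamiltonian cycle, and hence a
  canonical edge.  Each component of the 9-tuple is invariant under isomorphisms.  The last one even
  separates edges: the canonical labels of an edge determine the edge, so two edges whose orbits
  have the same largest label lie in a common orbit.  Therefore the canonical edges of \<open>H\<close> form a
  single orbit (\<open>canonical_edge_unique\<close>), and deleting a canonical edge yields a parent of \<open>H\<close> that
  is unique up to isomorphism (\<open>canonical_expansion_unique\<close>).  Iterating, every \<open>H\<close> has exactly one
  chain of ancestors up to isomorphism, one for each number of edges between \<open>n\<close> and that of \<open>H\<close>
  (\<open>ancestor_unique\<close>), and the chain starts at the cycle on \<open>n\<close> vertices (\<open>cycle_is_ancestor\<close>).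

  The procedure started at \<open>G\<close> walks through the tree of canonical descendants of \<open>G\<close>.  This is made
  precise by counting: the number of outputs isomorphic to \<open>H\<close> is 1 if \<open>G\<close> is an ancestor of \<open>H\<close>,
  and 0 otherwise (\<open>construct_count\<close>).  In the inductive step, a proper ancestor \<open>G\<close> of \<open>H\<close> has a
  canonical expansion that is still an ancestor of \<open>H\<close>; its orbit representative is one too, and no
  other representative is: two such expansions have equally many edges, so they are isomorphic by
  uniqueness of ancestors, and then uniqueness of the parent puts the two inserted pairs in the same
  orbit (\<open>count_representatives\<close>).  Counting outputs, instead of comparing two of them, turns
  completeness and irredundancy into one statement that passes through the recursion.\<close>

section \<open>Isomorphisms of simple graphs\<close>

definition relabel :: "('a \<Rightarrow> 'b) \<Rightarrow> 'a graph \<Rightarrow> 'b graph" where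
  "relabel f G = Graph (f ` verts G) ((`) f ` edges G)"

lemma simple_graphE:
  assumes "simple_graph G" "e \<in> edges G"
  obtains a b where "e = {a, b}" "a \<in> verts G" "b \<in> verts G" "a \<noteq> b"
  using assms unfolding simple_graph_def by blast

lemma simple_graph_edges_Pow: "simple_graph G \<Longrightarrow> edges G \<subseteq> Pow (verts G)"
  unfolding simple_graph_def by blast

lemma simple_graph_finite_edges: "simple_graph G \<Longrightarrow> finite (edges G)"
  by (meson finite_Pow_iff finite_subset simple_graph_def simple_graph_edges_Pow)

lemma graph_iso_inj_on: "graph_iso f G H \<Longrightarrow> inj_on f (verts G)"
  by (simp add: graph_iso_def bij_betw_def)

lemma graph_iso_verts: "graph_iso f G H \<Longrightarrow> f ` verts G = verts H"
  by (simp add: graph_iso_def bij_betw_def)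

lemma graph_iso_edge_iff:
  "\<lbrakk>graph_iso f G H; u \<in> verts G; v \<in> verts G\<rbrakk> \<Longrightarrow>
     {f u, f v} \<in> edges H \<longleftrightarrow> {u, v} \<in> edges G"
  by (simp add: graph_iso_def)

lemma graph_iso_id: "graph_iso id G G"
  by (simp add: graph_iso_def)

lemma graph_iso_comp: "graph_iso f G H \<Longrightarrow> graph_iso g H K \<Longrightarrow> graph_iso (g \<circ> f) G K"
  unfolding graph_iso_def by (auto intro: bij_betw_trans dest: bij_betwE)

lemma graph_iso_inv:
  assumes "graph_iso f G H"
  shows "graph_iso (inv_into (verts G) f) H G"
proof -
  have bij: "bij_betw f (verts G) (verts H)" using assms by (simp add: graph_iso_def)
  let ?g = "inv_into (verts G) f"
  have "?g v \<in> verts G \<and> f (?g v) = v" if "v \<in> verts H" for v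
    using that bij by (simp add: bij_betw_def f_inv_into_f inv_into_into)
  then show ?thesis
    using assms bij_betw_inv_into[OF bij] by (simp add: graph_iso_def)
qed

lemma isomorphic_refl: "isomorphic G G"
  unfolding isomorphic_def by (blast intro: graph_iso_id)

lemma isomorphic_sym: "isomorphic G H \<Longrightarrow> isomorphic H G"
  unfolding isomorphic_def by (blast intro: graph_iso_inv)

lemma isomorphic_trans: "isomorphic G H \<Longrightarrow> isomorphic H K \<Longrightarrow> isomorphic G K"
  unfolding isomorphic_def by (blast intro: graph_iso_comp)

text \<open>Between simple graphs an isomorphism determines its target, so invariance statements may be
  proved for \<open>relabel f G\<close> and transported from there.\<close>

lemma graph_iso_imp_relabel:
  assumes iso: "graph_iso f G H" and "simple_graph G" "simple_graph H"
  shows "relabel f G = H"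
proof -
  have "(`) f ` edges G = edges H"
  proof (intro equalityI subsetI)
    fix e assume "e \<in> (`) f ` edges G"
    then obtain e' where e': "e' \<in> edges G" "e = f ` e'" by blast
    with assms(2) obtain a b where "e' = {a, b}" "a \<in> verts G" "b \<in> verts G"
      by (blast elim: simple_graphE)
    with e' show "e \<in> edges H" using graph_iso_edge_iff[OF iso] by auto
  next
    fix e assume e: "e \<in> edges H"
    with assms(3) obtain c d where cd: "e = {c, d}" "c \<in> verts H" "d \<in> verts H"
      by (blast elim: simple_graphE)
    then obtain a b where ab: "a \<in> verts G" "b \<in> verts G" "c = f a" "d = f b"
      using graph_iso_verts[OF iso] by blast
    then have "{a, b} \<in> edges G" using graph_iso_edge_iff[OF iso] e cd by simp
    moreover have "e = f ` {a, b}" using ab cd by simp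
    ultimately show "e \<in> (`) f ` edges G" by blast
  qed
  then show ?thesis
    using graph_iso_verts[OF iso] by (cases H) (simp add: relabel_def)
qed

lemma graph_iso_relabel:
  assumes inj: "inj_on f (verts G)" and G: "edges G \<subseteq> Pow (verts G)"
  shows "graph_iso f G (relabel f G)"
  unfolding graph_iso_def
proof (intro conjI ballI)
  show "bij_betw f (verts G) (verts (relabel f G))"
    using inj by (simp add: relabel_def inj_on_imp_bij_betw)
next
  fix u v assume uv: "u \<in> verts G" "v \<in> verts G"
  have "{f u, f v} \<in> edges (relabel f G) \<longleftrightarrow> (\<exists>e\<in>edges G. f ` e = f ` {u, v})"
    by (auto simp: relabel_def image_iff)
  also have "\<dots> \<longleftrightarrow> (\<exists>e\<in>edges G. e = {u, v})"
    using inj_on_image_eq_iff[OF inj] G uv by (metis PowD empty_subsetI insert_subset subsetD)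
  finally show "{u, v} \<in> edges G \<longleftrightarrow> {f u, f v} \<in> edges (relabel f G)" by blast
qed

lemma simple_graph_relabel:
  assumes "simple_graph G" "inj_on f (verts G)"
  shows "simple_graph (relabel f G)"
proof -
  have "f ` e \<in> {{a, b} |a b. a \<in> f ` verts G \<and> b \<in> f ` verts G \<and> a \<noteq> b}"
    if "e \<in> edges G" for e
  proof -
    obtain a b where "e = {a, b}" "a \<in> verts G" "b \<in> verts G" "a \<noteq> b"
      using assms(1) \<open>e \<in> edges G\<close> by (rule simple_graphE)
    then show ?thesis using inj_onD[OF assms(2)] by force
  qed
  then show ?thesis
    using assms(1) by (auto simp: simple_graph_def relabel_def)
qed

lemma relabel_inv_into:
  assumes "inj_on f V" "verts C \<subseteq> V" "edges C \<subseteq> Pow V"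
  shows "relabel (inv_into V f) (relabel f C) = C"
proof -
  have inv: "inv_into V f ` f ` A = A" if "A \<subseteq> V" for A
    using assms(1) that by (simp add: inv_into_image_cancel)
  then have "(\<lambda>A. inv_into V f ` f ` A) ` edges C = (\<lambda>A. A) ` edges C"
    using assms(3) by (intro image_cong[OF refl]) blast
  then have "(`) (inv_into V f) ` (`) f ` edges C = edges C"
    by (simp add: image_comp comp_def)
  with inv assms(2) show ?thesis by (cases C) (simp add: relabel_def)
qed

lemma graph_iso_card_edges:
  assumes "graph_iso f G H" "simple_graph G" "simple_graph H"
  shows "card (edges G) = card (edges H)"
proof -
  have "inj_on ((`) f) (edges G)"
    using graph_iso_inj_on[OF assms(1)] simple_graph_edges_Pow[OF assms(2)]
    by (meson inj_on_image_Pow inj_on_subset)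
  then have "card ((`) f ` edges G) = card (edges G)" by (rule card_image)
  then show ?thesis using graph_iso_imp_relabel[OF assms] by (auto simp: relabel_def)
qed

lemma graph_iso_pair_eq_iff:
  assumes "graph_iso f G H" "a \<in> verts G" "b \<in> verts G" "u \<in> verts G" "v \<in> verts G"
  shows "{f u, f v} = {f a, f b} \<longleftrightarrow> {u, v} = {a, b}"
  using inj_on_image_eq_iff[OF graph_iso_inj_on[OF assms(1)], of "{u, v}" "{a, b}"] assms by simp

lemma graph_iso_add_edge:
  assumes "graph_iso f G H" "a \<in> verts G" "b \<in> verts G"
  shows "graph_iso f (add_edge G {a, b}) (add_edge H {f a, f b})"
  using assms(1) graph_iso_pair_eq_iff[OF assms] by (simp add: graph_iso_def add_edge_def)

lemma graph_iso_remove_edge: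
  assumes "graph_iso f G H" "a \<in> verts G" "b \<in> verts G"
  shows "graph_iso f (remove_edge G {a, b}) (remove_edge H {f a, f b})"
  using assms(1) graph_iso_pair_eq_iff[OF assms] by (simp add: graph_iso_def remove_edge_def)

lemma verts_add_edge [simp]: "verts (add_edge G e) = verts G"
  by (simp add: add_edge_def)

lemma verts_remove_edge [simp]: "verts (remove_edge G e) = verts G"
  by (simp add: remove_edge_def)

lemma remove_add_edge: "e \<notin> edges G \<Longrightarrow> remove_edge (add_edge G e) e = G"
  by (cases G) (simp add: add_edge_def remove_edge_def)

lemma add_remove_edge: "e \<in> edges G \<Longrightarrow> add_edge (remove_edge G e) e = G"
  by (cases G) (simp add: add_edge_def remove_edge_def insert_absorb)

lemma card_edges_add_edge:
  "\<lbrakk>simple_graph G; e \<notin> edges G\<rbrakk> \<Longrightarrow> card (edges (add_edge G e)) = Suc (card (edges G))"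
  by (simp add: add_edge_def simple_graph_finite_edges)

lemma nonadjacent_pairs_iff:
  "{a, b} \<in> nonadjacent_pairs G \<longleftrightarrow>
     a \<in> verts G \<and> b \<in> verts G \<and> a \<noteq> b \<and> {a, b} \<notin> edges G"
  unfolding nonadjacent_pairs_def by (auto simp: doubleton_eq_iff insert_commute)

lemma nonadjacent_pairs_iso:
  assumes "graph_iso f G H" "{a, b} \<in> nonadjacent_pairs G"
  shows "{f a, f b} \<in> nonadjacent_pairs H"
proof -
  have "a \<in> verts G" "b \<in> verts G" "a \<noteq> b" "{a, b} \<notin> edges G"
    using assms(2) by (simp_all add: nonadjacent_pairs_iff)
  then show ?thesis
    using graph_iso_edge_iff[OF assms(1)] graph_iso_verts[OF assms(1)]
      inj_onD[OF graph_iso_inj_on[OF assms(1)]]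
    by (auto simp: nonadjacent_pairs_iff)
qed

section \<open>Hamiltonian cycles\<close>

lemma is_cycle_obtain:
  assumes "is_cycle C"
  obtains vs where "3 \<le> length vs" "distinct vs" "verts C = set vs"
    "edges C = (\<lambda>i. {vs ! i, vs ! (Suc i mod length vs)}) ` {..<length vs}"
    "\<forall>i. Suc i mod length vs < length vs"
proof -
  obtain vs where vs: "3 \<le> length vs" "distinct vs" "verts C = set vs"
    and e: "edges C = {{vs ! i, vs ! (Suc i mod length vs)} |i. i < length vs}"
    using assms unfolding is_cycle_def by blast
  have "edges C = (\<lambda>i. {vs ! i, vs ! (Suc i mod length vs)}) ` {..<length vs}"
    unfolding e by blast
  moreover have "Suc i mod length vs < length vs" for i using vs(1) by (intro mod_less_divisor) linarith
  ultimately show ?thesis using that vs by blast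
qed

lemma is_cycle_relabel:
  assumes "is_cycle C" "inj_on f (verts C)"
  shows "is_cycle (relabel f C)"
proof -
  obtain vs where vs: "3 \<le> length vs" "distinct vs" "verts C = set vs"
    and e: "edges C = (\<lambda>i. {vs ! i, vs ! (Suc i mod length vs)}) ` {..<length vs}"
    and lt: "\<forall>i. Suc i mod length vs < length vs"
    using assms(1) by (rule is_cycle_obtain)
  have "edges (relabel f C) =
      (\<lambda>i. {f (vs ! i), f (vs ! (Suc i mod length vs))}) ` {..<length vs}"
    by (simp add: relabel_def e image_image)
  also have "\<dots> = {{f (vs ! i), f (vs ! (Suc i mod length vs))} |i. i < length vs}" by blast
  also have "\<dots> =
      {{map f vs ! i, map f vs ! (Suc i mod length (map f vs))} |i. i < length (map f vs)}"
    using lt by (simp cong: rev_conj_cong)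
  finally have "edges (relabel f C) =
      {{map f vs ! i, map f vs ! (Suc i mod length (map f vs))} |i. i < length (map f vs)}" .
  moreover have "distinct (map f vs)" using vs assms(2) by (simp add: distinct_map)
  ultimately show ?thesis unfolding is_cycle_def
    using vs by (intro exI[of _ "map f vs"]) (simp add: relabel_def)
qed

lemma cycle_simple_graph:
  assumes "is_cycle C"
  shows "simple_graph C"
proof -
  obtain vs where vs: "3 \<le> length vs" "distinct vs" "verts C = set vs"
    and e: "edges C = (\<lambda>i. {vs ! i, vs ! (Suc i mod length vs)}) ` {..<length vs}"
    and lt: "\<forall>i. Suc i mod length vs < length vs"
    using assms by (rule is_cycle_obtain)
  have "vs ! i \<noteq> vs ! (Suc i mod length vs)" if "i < length vs" for i
  proof -
    have "i \<noteq> Suc i mod length vs" using that vs(1) by (auto simp: mod_Suc)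
    then show ?thesis using that lt vs(2) nth_eq_iff_index_eq by blast
  qed
  then show ?thesis unfolding simple_graph_def e vs(3) using lt by auto (metis nth_mem)
qed

lemma cycle_card_edges:
  assumes "is_cycle C"
  shows "card (edges C) = card (verts C)"
proof -
  obtain vs where vs: "3 \<le> length vs" "distinct vs" "verts C = set vs"
    and e: "edges C = (\<lambda>i. {vs ! i, vs ! (Suc i mod length vs)}) ` {..<length vs}"
    and lt: "\<forall>i. Suc i mod length vs < length vs"
    using assms by (rule is_cycle_obtain)
  have "inj_on (\<lambda>i. {vs ! i, vs ! (Suc i mod length vs)}) {..<length vs}"
  proof (rule inj_onI)
    fix i j assume ij: "i \<in> {..<length vs}" "j \<in> {..<length vs}"
      and eq: "{vs ! i, vs ! (Suc i mod length vs)} = {vs ! j, vs ! (Suc j mod length vs)}"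
    from eq have "i = j \<or> i = Suc j mod length vs \<and> Suc i mod length vs = j"
      using ij lt nth_eq_iff_index_eq[OF vs(2)] by (auto simp: doubleton_eq_iff)
    then show "i = j"
      using vs(1) ij by (auto simp: mod_Suc split: if_splits)
  qed
  then show ?thesis using vs e by (simp add: card_image distinct_card)
qed

text \<open>A cycle has as many edges as vertices, so a hamiltonian cycle of it uses all its edges.\<close>

lemma cycle_uniquely_hamiltonian:
  assumes "is_cycle C"
  shows "uniquely_hamiltonian C"
proof -
  have "D = C" if "hamiltonian_cycle D C" for D
  proof -
    from that have D: "is_cycle D" "verts D = verts C" "edges D \<subseteq> edges C"
      by (auto simp: hamiltonian_cycle_def subgraph_def)
    have "edges D = edges C"
      using D assms cycle_card_edges cycle_simple_graph simple_graph_finite_edges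
      by (metis card_subset_eq)
    with D show ?thesis by (cases D; cases C) auto
  qed
  moreover have "hamiltonian_cycle C C"
    using assms by (simp add: hamiltonian_cycle_def subgraph_def)
  ultimately show ?thesis
    using cycle_simple_graph[OF assms] by (auto simp: uniquely_hamiltonian_def)
qed

lemma cycles_isomorphic:
  fixes C :: "'a graph" and D :: "'b graph"
  assumes "is_cycle C" "is_cycle D" "card (verts C) = card (verts D)"
  shows "isomorphic C D"
proof -
  obtain vs where vs: "3 \<le> length vs" "distinct vs" "verts C = set vs"
    and e: "edges C = (\<lambda>i. {vs ! i, vs ! (Suc i mod length vs)}) ` {..<length vs}"
    and lt: "\<forall>i. Suc i mod length vs < length vs"
    using assms(1) by (rule is_cycle_obtain)
  obtain ws where ws: "3 \<le> length ws" "distinct ws" "verts D = set ws"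
    and e': "edges D = (\<lambda>i. {ws ! i, ws ! (Suc i mod length ws)}) ` {..<length ws}"
    using assms(2) by (rule is_cycle_obtain)
  have len: "length ws = length vs"
    using assms(3) vs ws by (simp add: distinct_card)
  define f where "f v = ws ! (THE i. i < length vs \<and> vs ! i = v)" for v
  have f: "f (vs ! i) = ws ! i" if "i < length vs" for i
    unfolding f_def using that vs(2)
    by (intro arg_cong[of _ _ "(!) ws"] the_equality) (auto simp: nth_eq_iff_index_eq)
  have "map f vs = ws" using f len by (intro nth_equalityI) auto
  then have img: "f ` set vs = set ws" and inj: "inj_on f (set vs)"
    using ws(2) by (auto simp: distinct_map)
  have "(`) f ` edges C = edges D"
    unfolding e e' image_image len using f lt by (intro image_cong) auto
  then have "relabel f C = D"
    using img vs(3) ws(3) by (cases D) (simp add: relabel_def)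
  moreover have "graph_iso f C (relabel f C)"
    using inj vs(3) simple_graph_edges_Pow[OF cycle_simple_graph[OF assms(1)]]
    by (intro graph_iso_relabel) auto
  ultimately show ?thesis unfolding isomorphic_def by blast
qed

lemma uniquely_hamiltonian_simple: "uniquely_hamiltonian G \<Longrightarrow> simple_graph G"
  by (simp add: uniquely_hamiltonian_def)

lemma ham_cycle_hamiltonian: "uniquely_hamiltonian G \<Longrightarrow> hamiltonian_cycle (ham_cycle G) G"
  unfolding uniquely_hamiltonian_def ham_cycle_def by (rule theI') blast

lemma ham_cycle_unique:
  "uniquely_hamiltonian G \<Longrightarrow> hamiltonian_cycle C G \<Longrightarrow> ham_cycle G = C"
  unfolding uniquely_hamiltonian_def ham_cycle_def by (blast intro: the1_equality)

lemma hamiltonian_cycle_relabel: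
  assumes iso: "graph_iso f G H" and "simple_graph G" "simple_graph H"
    and C: "hamiltonian_cycle C G"
  shows "hamiltonian_cycle (relabel f C) H"
proof -
  have "subgraph (relabel f C) (relabel f G)"
    using C by (auto simp: hamiltonian_cycle_def subgraph_def relabel_def)
  moreover have "is_cycle (relabel f C)"
    using C graph_iso_inj_on[OF iso] by (auto simp: hamiltonian_cycle_def intro: is_cycle_relabel)
  moreover have "verts (relabel f C) = verts H"
    using C graph_iso_verts[OF iso] by (simp add: hamiltonian_cycle_def relabel_def)
  ultimately show ?thesis
    using graph_iso_imp_relabel[OF assms(1-3)] by (simp add: hamiltonian_cycle_def)
qed

text \<open>A hamiltonian cycle of \<open>H\<close> is pulled back to \<open>G\<close> and pushed forward again; since \<open>G\<close> has only one
  such cycle, \<open>H\<close> has only one.\<close>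

lemma uniquely_hamiltonian_iso:
  assumes iso: "graph_iso f G H" and G: "uniquely_hamiltonian G" and H: "simple_graph H"
  shows "uniquely_hamiltonian H"
proof -
  note Gs = uniquely_hamiltonian_simple[OF G]
  let ?g = "inv_into (verts G) f"
  have g: "graph_iso ?g H G" by (rule graph_iso_inv[OF iso])
  have "D = relabel f (ham_cycle G)" if D: "hamiltonian_cycle D H" for D
  proof -
    let ?h = "inv_into (verts H) ?g"
    have "relabel ?g D = ham_cycle G"
      using hamiltonian_cycle_relabel[OF g H Gs D] ham_cycle_unique[OF G] by simp
    moreover have "relabel ?h (relabel ?g D) = D"
      using D simple_graph_edges_Pow[OF H] graph_iso_inj_on[OF g]
      by (intro relabel_inv_into) (auto simp: hamiltonian_cycle_def subgraph_def)
    \<comment> \<open>The double inverse of \<open>f\<close> agrees with \<open>f\<close> on \<open>verts G\<close>, though perhaps not elsewhere.\<close>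
    moreover have "relabel ?h C = relabel f C" if "hamiltonian_cycle C G" for C
    proof -
      have eq: "?h v = f v" if "v \<in> verts G" for v
        using that graph_iso_inj_on[OF iso] graph_iso_verts[OF iso] graph_iso_inj_on[OF g]
        by (metis imageI inv_into_f_f)
      have "?h ` A = f ` A" if "A \<subseteq> verts G" for A
        using eq that by (intro image_cong) auto
      then show ?thesis
        using \<open>hamiltonian_cycle C G\<close> simple_graph_edges_Pow[OF Gs]
        unfolding relabel_def hamiltonian_cycle_def subgraph_def
        by (intro arg_cong2[of _ _ _ _ Graph] image_cong[OF refl, of "edges C"]) blast+
    qed
    ultimately show ?thesis using ham_cycle_hamiltonian[OF G] by metis
  qed
  then show ?thesis
    using hamiltonian_cycle_relabel[OF iso Gs H ham_cycle_hamiltonian[OF G]] H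
    unfolding uniquely_hamiltonian_def by blast
qed

text \<open>Labellings live on one vertex type only.  A graph on another type is first copied onto the vertex
  set of \<open>C\<close>, where the labelling applies.\<close>

lemma isomorphic_image_graph:
  fixes C :: "'a graph" and H :: "'b graph"
  assumes "uniquely_hamiltonian H" "finite (verts C)" "card (verts C) = card (verts H)"
  obtains H' :: "'a graph" where "uniquely_hamiltonian H'" "verts H' = verts C" "isomorphic H' H"
proof -
  note H = uniquely_hamiltonian_simple[OF assms(1)]
  obtain f where f: "bij_betw f (verts H) (verts C)"
    using assms H by (metis finite_same_card_bij simple_graph_def)
  then have inj: "inj_on f (verts H)" by (simp add: bij_betw_def)
  have iso: "graph_iso f H (relabel f H)"
    by (rule graph_iso_relabel[OF inj simple_graph_edges_Pow[OF H]])
  moreover have "verts (relabel f H) = verts C" using f by (simp add: relabel_def bij_betw_def)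
  moreover have "uniquely_hamiltonian (relabel f H)"
    by (rule uniquely_hamiltonian_iso[OF iso assms(1) simple_graph_relabel[OF H inj]])
  ultimately show ?thesis using that isomorphic_sym isomorphic_def by metis
qed

lemma ham_cycle_iso:
  assumes iso: "graph_iso f G H" and G: "uniquely_hamiltonian G" and H: "uniquely_hamiltonian H"
  shows "graph_iso f (ham_cycle G) (ham_cycle H)"
proof -
  note Gs = uniquely_hamiltonian_simple[OF G]
  note Hs = uniquely_hamiltonian_simple[OF H]
  have hG: "hamiltonian_cycle (ham_cycle G) G" by (rule ham_cycle_hamiltonian[OF G])
  then have "ham_cycle H = relabel f (ham_cycle G)"
    by (intro ham_cycle_unique[OF H] hamiltonian_cycle_relabel[OF iso Gs Hs])
  moreover have "graph_iso f (ham_cycle G) (relabel f (ham_cycle G))"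
    using hG graph_iso_inj_on[OF iso]
    by (intro graph_iso_relabel simple_graph_edges_Pow cycle_simple_graph)
      (auto simp: hamiltonian_cycle_def)
  ultimately show ?thesis by simp
qed

lemma verts_ham_cycle: "uniquely_hamiltonian G \<Longrightarrow> verts (ham_cycle G) = verts G"
  using ham_cycle_hamiltonian by (auto simp: hamiltonian_cycle_def)

text \<open>Deleting an edge creates no hamiltonian cycle, and deleting one off \<open>ham_cycle G\<close> keeps that
  cycle.\<close>

lemma reducible_edge_off_ham_cycle:
  assumes G: "uniquely_hamiltonian G" and e: "e \<in> edges G" "e \<notin> edges (ham_cycle G)"
  shows "reducible G e"
proof -
  have "hamiltonian_cycle C (remove_edge G e) \<longleftrightarrow> C = ham_cycle G" for C
  proof
    assume "hamiltonian_cycle C (remove_edge G e)"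
    then have "hamiltonian_cycle C G"
      by (auto simp: hamiltonian_cycle_def subgraph_def remove_edge_def)
    then show "C = ham_cycle G" using ham_cycle_unique[OF G] by simp
  next
    assume "C = ham_cycle G"
    then show "hamiltonian_cycle C (remove_edge G e)"
      using ham_cycle_hamiltonian[OF G] e
      by (auto simp: hamiltonian_cycle_def subgraph_def remove_edge_def)
  qed
  moreover have "simple_graph (remove_edge G e)"
    using uniquely_hamiltonian_simple[OF G] by (auto simp: simple_graph_def remove_edge_def)
  ultimately show ?thesis using G e by (simp add: reducible_def uniquely_hamiltonian_def)
qed

lemma irreducible_imp_cycle:
  assumes G: "uniquely_hamiltonian G" and "\<And>e. \<not> reducible G e"
  shows "is_cycle G"
proof -
  have "edges G \<subseteq> edges (ham_cycle G)"
    using reducible_edge_off_ham_cycle[OF G] assms(2) by blast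
  moreover have "hamiltonian_cycle (ham_cycle G) G" by (rule ham_cycle_hamiltonian[OF G])
  ultimately have "ham_cycle G = G"
    by (cases G; cases "ham_cycle G") (auto simp: hamiltonian_cycle_def subgraph_def)
  then show ?thesis using \<open>hamiltonian_cycle (ham_cycle G) G\<close> by (simp add: hamiltonian_cycle_def)
qed

lemma reducible_edgeE:
  assumes "reducible G {a, b}"
  shows "a \<in> verts G" "b \<in> verts G" "a \<noteq> b" "{a, b} \<in> edges G" "uniquely_hamiltonian G"
    "uniquely_hamiltonian (remove_edge G {a, b})"
proof -
  show 1: "{a, b} \<in> edges G" and 2: "uniquely_hamiltonian G"
    and "uniquely_hamiltonian (remove_edge G {a, b})"
    using assms by (auto simp: reducible_def)
  from uniquely_hamiltonian_simple[OF 2] 1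
  show "a \<in> verts G" "b \<in> verts G" "a \<noteq> b"
    by (auto elim!: simple_graphE simp: doubleton_eq_iff)
qed

lemma reducible_iso:
  assumes iso: "graph_iso f G H" and r: "reducible G {a, b}" and H: "simple_graph H"
  shows "reducible H {f a, f b}"
proof -
  note ab = reducible_edgeE[OF r]
  have "simple_graph (remove_edge H {f a, f b})"
    using H by (auto simp: simple_graph_def remove_edge_def)
  then have "uniquely_hamiltonian (remove_edge H {f a, f b})"
    using uniquely_hamiltonian_iso[OF graph_iso_remove_edge[OF iso]] ab by blast
  moreover have "uniquely_hamiltonian H" using uniquely_hamiltonian_iso[OF iso _ H] ab by blast
  moreover have "{f a, f b} \<in> edges H" using graph_iso_edge_iff[OF iso] ab by simp
  ultimately show ?thesis by (simp add: reducible_def)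
qed

section \<open>Invariance of the 9-tuple\<close>

lemma path_between_iso:
  assumes iso: "graph_iso f G H" and p: "path_between G u p v"
  shows "path_between H (f u) (map f p) (f v)"
proof -
  have "successively (\<lambda>x y. {f x, f y} \<in> edges H) p"
    using p graph_iso_edge_iff[OF iso]
    unfolding path_between_def by (auto elim!: successively_mono)
  then show ?thesis
    using p graph_iso_verts[OF iso] inj_on_subset[OF graph_iso_inj_on[OF iso]]
    unfolding path_between_def
    by (auto simp: hd_map last_map distinct_map successively_map)
qed

lemma distance_iso_le:
  assumes "graph_iso f G H"
  shows "distance H (f u) (f v) \<le> distance G u v"
  unfolding distance_def
proof (rule INF_greatest)
  fix p assume "p \<in> {p. path_between G u p v}"
  then have "path_between H (f u) (map f p) (f v)" using path_between_iso[OF assms] by simp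
  then show "(INF p\<in>{p. path_between H (f u) p (f v)}. enat (length p - 1)) \<le> enat (length p - 1)"
    by (intro INF_lower2[of "map f p"]) auto
qed

lemma distance_iso:
  assumes "graph_iso f G H" "u \<in> verts G" "v \<in> verts G"
  shows "distance H (f u) (f v) = distance G u v"
proof (rule antisym)
  show "distance G u v \<le> distance H (f u) (f v)"
    using distance_iso_le[OF graph_iso_inv[OF assms(1)], of "f u" "f v"]
      graph_iso_inj_on[OF assms(1)] assms by simp
qed (rule distance_iso_le[OF assms(1)])

lemma distance_commute: "distance G u v = distance G v u"
proof -
  have "distance G u v \<le> distance G v u" for u v
    unfolding distance_def
  proof (rule INF_greatest)
    fix p assume "p \<in> {p. path_between G v p u}"
    then have "path_between G u (rev p) v"
      by (auto simp: path_between_def hd_rev last_rev insert_commute)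
    then show "(INF p\<in>{p. path_between G u p v}. enat (length p - 1)) \<le> enat (length p - 1)"
      by (intro INF_lower2[of "rev p"]) auto
  qed
  then show ?thesis by (simp add: antisym)
qed

lemma neighbours_iso:
  assumes iso: "graph_iso f G H" and "v \<in> verts G"
  shows "neighbours H (f v) = f ` neighbours G v"
  using graph_iso_edge_iff[OF iso \<open>v \<in> verts G\<close>]
  by (auto simp: neighbours_def graph_iso_verts[OF iso, symmetric])

lemma neighbours_subset: "neighbours G v \<subseteq> verts G"
  by (auto simp: neighbours_def)

lemma degree_iso:
  assumes "graph_iso f G H" "v \<in> verts G"
  shows "degree H (f v) = degree G v"
  unfolding degree_def neighbours_iso[OF assms]
  by (intro card_image inj_on_subset[OF graph_iso_inj_on[OF assms(1)]] neighbours_subset)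

lemma sigma_iso:
  assumes iso: "graph_iso f G H" and G: "uniquely_hamiltonian G" and H: "uniquely_hamiltonian H"
    and v: "v \<in> verts G"
  shows "sigma H (f v) = sigma G v"
proof -
  let ?N = "neighbours (ham_cycle G) v"
  have N: "?N \<subseteq> verts G" using neighbours_subset verts_ham_cycle[OF G] by metis
  have "sigma H (f v) = (\<Sum>w\<in>f ` ?N. degree H w)"
    using neighbours_iso[OF ham_cycle_iso[OF iso G H]] v verts_ham_cycle[OF G]
    by (simp add: sigma_def)
  also have "\<dots> = (\<Sum>w\<in>?N. degree H (f w))"
    using inj_on_subset[OF graph_iso_inj_on[OF iso] N] by (simp add: sum.reindex)
  also have "\<dots> = sigma G v"
    unfolding sigma_def using N degree_iso[OF iso] by (intro sum.cong) auto
  finally show ?thesis .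
qed


text \<open>The two isomorphisms need not agree, because they differ by an automorphism of \<open>H\<close>.  This is what
  allows the label-preserving isomorphism of \<open>canonical_labelling_iso\<close> to be compared with an
  arbitrary one.\<close>

lemma pair_orbit_iso:
  assumes iso: "graph_iso f G H" and g: "graph_iso g G H" and e: "e \<subseteq> verts G"
    and d: "d \<in> pair_orbit G e"
  shows "g ` d \<in> pair_orbit H (f ` e)"
proof -
  obtain h where h: "graph_iso h G G" and d: "d = h ` e"
    using d by (auto simp: pair_orbit_def)
  let ?k = "g \<circ> h \<circ> inv_into (verts G) f"
  have "graph_iso ?k H H"
    by (intro graph_iso_comp[OF graph_iso_inv[OF iso]] graph_iso_comp[OF h] g)
  moreover have "g ` d = ?k ` f ` e"
    using inv_into_image_cancel[OF graph_iso_inj_on[OF iso] e] unfolding d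
    by (simp only: image_comp [symmetric])
  ultimately show ?thesis unfolding pair_orbit_def by blast
qed

lemma pair_orbit_self: "e \<in> pair_orbit G e"
  unfolding pair_orbit_def using graph_iso_id by (metis (mono_tags, lifting) image_id id_apply mem_Collect_eq)

lemma pair_orbit_eq:
  assumes e: "e \<subseteq> verts G" and d: "d \<in> pair_orbit G e"
  shows "pair_orbit G d = pair_orbit G e"
proof -
  obtain h where h: "graph_iso h G G" and d: "d = h ` e"
    using d by (auto simp: pair_orbit_def)
  have d': "d \<subseteq> verts G" using graph_iso_verts[OF h] e d by blast
  have "inv_into (verts G) h ` d = e"
    using inv_into_image_cancel[OF graph_iso_inj_on[OF h] e] d by simp
  then have "pair_orbit G d \<subseteq> pair_orbit G e"
    using pair_orbit_iso[OF graph_iso_inv[OF h] graph_iso_id d'] by auto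
  moreover have "pair_orbit G e \<subseteq> pair_orbit G d"
    using pair_orbit_iso[OF h graph_iso_id e] d by auto
  ultimately show ?thesis by blast
qed

lemma pair_orbit_subset_Pow: "e \<subseteq> verts G \<Longrightarrow> pair_orbit G e \<subseteq> Pow (verts G)"
  unfolding pair_orbit_def using graph_iso_verts by fastforce

lemma canonical_labelling_inj_on:
  "canonical_labelling lab \<Longrightarrow> simple_graph G \<Longrightarrow> inj_on (lab G) (verts G)"
  by (auto simp: canonical_labelling_def bij_betw_def)

text \<open>A canonical labelling sends isomorphic graphs to the same labelled graph, so labelling \<open>G\<close> and
  undoing the labelling of \<open>H\<close> is an isomorphism.\<close>

lemma canonical_labelling_iso:
  assumes lab: "canonical_labelling lab" and G: "simple_graph G" and H: "simple_graph H"
    and "isomorphic G H"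
  obtains g where "graph_iso g G H" "\<And>v. v \<in> verts G \<Longrightarrow> lab H (g v) = lab G v"
proof -
  obtain f where f: "graph_iso f G H" using \<open>isomorphic G H\<close> by (auto simp: isomorphic_def)
  have bG: "bij_betw (lab G) (verts G) {1..card (verts G)}"
    and bH: "bij_betw (lab H) (verts H) {1..card (verts H)}"
    and eq: "(`) (lab G) ` edges G = (`) (lab H) ` edges H"
    using assms by (auto simp: canonical_labelling_def)
  have card: "card (verts G) = card (verts H)"
    using f by (auto simp: graph_iso_def bij_betw_same_card)
  have "relabel (lab G) G = relabel (lab H) H"
    using eq bG bH card by (simp add: relabel_def bij_betw_def)
  then have "graph_iso (lab G) G (relabel (lab H) H)" "graph_iso (lab H) H (relabel (lab H) H)"
    using graph_iso_relabel simple_graph_edges_Pow G H bG bH by (metis bij_betw_def)+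
  then have "graph_iso (inv_into (verts H) (lab H) \<circ> lab G) G H"
    by (blast intro: graph_iso_comp graph_iso_inv)
  moreover have "lab H ((inv_into (verts H) (lab H) \<circ> lab G) v) = lab G v" if "v \<in> verts G" for v
    using bij_betwE[OF bG] that card bij_betw_inv_into_right[OF bH] by simp
  ultimately show ?thesis using that by blast
qed

text \<open>An arbitrary isomorphism does not preserve labels, hence the label of a single edge is not an
  invariant.  The label-preserving isomorphism, however, carries the orbit of \<open>e\<close> onto the orbit of
  its image under \<open>f\<close>, so the set of labels that occur on an orbit is one.\<close>

lemma orbit_labels_iso:
  assumes lab: "canonical_labelling lab" and G: "simple_graph G" and H: "simple_graph H"
    and iso: "graph_iso f G H" and e: "e \<subseteq> verts G"
  shows "edge_label lab H ` pair_orbit H (f ` e) = edge_label lab G ` pair_orbit G e"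
proof -
  have sub: "edge_label lab G ` pair_orbit G e \<subseteq> edge_label lab H ` pair_orbit H (f ` e)"
    if sG: "simple_graph G" and sH: "simple_graph H" and iso: "graph_iso f G H" and e: "e \<subseteq> verts G"
    for G H :: "'a graph" and f e
  proof
    fix x assume "x \<in> edge_label lab G ` pair_orbit G e"
    then obtain d where d: "d \<in> pair_orbit G e" "x = edge_label lab G d" by blast
    obtain g where g: "graph_iso g G H" and gl: "\<And>v. v \<in> verts G \<Longrightarrow> lab H (g v) = lab G v"
      using canonical_labelling_iso[OF lab sG sH] iso unfolding isomorphic_def by blast
    have "d \<subseteq> verts G" using d pair_orbit_subset_Pow[OF e] by blast
    then have "lab H ` g ` d = lab G ` d" using gl by (auto simp: image_image intro!: image_cong)
    then have "x = edge_label lab H (g ` d)" using d by (simp add: edge_label_def)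
    then show "x \<in> edge_label lab H ` pair_orbit H (f ` e)"
      using pair_orbit_iso[OF iso g e d(1)] by blast
  qed
  have "f ` e \<subseteq> verts H" using e graph_iso_verts[OF iso] by blast
  from sub[OF H G graph_iso_inv[OF iso] this] sub[OF G H iso e]
  show ?thesis
    using inv_into_image_cancel[OF graph_iso_inj_on[OF iso] e] by auto
qed

lemma edge_tuple_iso:
  assumes lab: "canonical_labelling lab"
    and G: "uniquely_hamiltonian G" and H: "uniquely_hamiltonian H"
    and iso: "graph_iso f G H" and a: "a \<in> verts G" and b: "b \<in> verts G"
  shows "edge_tuple lab H (f a) (f b) = edge_tuple lab G a b"
proof -
  note inj = graph_iso_inj_on[OF iso]
  have "neighbours H (f a) \<inter> neighbours H (f b) = f ` (neighbours G a \<inter> neighbours G b)"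
    unfolding neighbours_iso[OF iso a] neighbours_iso[OF iso b]
    by (intro inj_on_image_Int[OF inj, symmetric] neighbours_subset)
  then have common: "card (neighbours H (f a) \<inter> neighbours H (f b)) =
      card (neighbours G a \<inter> neighbours G b)"
    using inj_on_subset[OF inj] neighbours_subset by (metis card_image inf.coboundedI1)
  have "{v \<in> verts H. distance H (f a) v \<le> 2 \<and> distance H (f b) v \<le> 2} =
      f ` {v \<in> verts G. distance G a v \<le> 2 \<and> distance G b v \<le> 2}"
    using distance_iso[OF iso] a b by (auto simp: graph_iso_verts[OF iso, symmetric])
  then have near: "card {v \<in> verts H. distance H (f a) v \<le> 2 \<and> distance H (f b) v \<le> 2} =
      card {v \<in> verts G. distance G a v \<le> 2 \<and> distance G b v \<le> 2}"
    using inj_on_subset[OF inj] by (metis (no_types, lifting) card_image mem_Collect_eq subsetI)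
  have "edge_label lab H ` pair_orbit H {f a, f b} = edge_label lab G ` pair_orbit G {a, b}"
    using orbit_labels_iso[OF lab uniquely_hamiltonian_simple[OF G]
        uniquely_hamiltonian_simple[OF H] iso, of "{a, b}"] a b by simp
  then show ?thesis
    using common near a b degree_iso[OF iso] sigma_iso[OF iso G H]
      distance_iso[OF ham_cycle_iso[OF iso G H]] verts_ham_cycle[OF G]
    by (simp add: edge_tuple_def)
qed

lemma edge_tuple_commute: "edge_tuple lab G a b = edge_tuple lab G b a"
proof -
  have "{v \<in> verts G. distance G a v \<le> 2 \<and> distance G b v \<le> 2} =
      {v \<in> verts G. distance G b v \<le> 2 \<and> distance G a v \<le> 2}" by blast
  then show ?thesis
    unfolding edge_tuple_def
    by (simp only: max.commute[of "degree G a" "degree G b"] min.commute[of "degree G a" "degree G b"]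
        max.commute[of "sigma G a" "sigma G b"] min.commute[of "sigma G a" "sigma G b"]
        distance_commute[of "ham_cycle G" a b] insert_commute[of a b]
        Int_commute[of "neighbours G a" "neighbours G b"])
qed

lemma edge_label_determines_edge:
  assumes lab: "canonical_labelling lab" and G: "simple_graph G"
    and uv: "u \<in> verts G" "v \<in> verts G" and xy: "x \<in> verts G" "y \<in> verts G"
    and eq: "edge_label lab G {u, v} = edge_label lab G {x, y}"
  shows "{u, v} = {x, y}"
proof -
  have "lab G ` {u, v} = lab G ` {x, y}"
    using eq by (auto simp: edge_label_def max_def min_def split: if_splits)
  then show ?thesis
    using inj_on_image_eq_iff[OF canonical_labelling_inj_on[OF lab G], of "{u, v}" "{x, y}"] uv xy
    by simp
qed

text \<open>The largest label of an orbit is attained by an edge of it.  If the two maxima agree, then the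
  edges attaining them are equal, since a label determines its edge, and so the two orbits meet.\<close>

lemma same_tuple_imp_same_orbit:
  assumes lab: "canonical_labelling lab" and G: "simple_graph G"
    and ab: "a \<in> verts G" "b \<in> verts G" and cd: "c \<in> verts G" "d \<in> verts G"
    and eq: "edge_tuple lab G a b = edge_tuple lab G c d"
  shows "{c, d} \<in> pair_orbit G {a, b}"
proof -
  have attained: "\<exists>x y. x \<in> verts G \<and> y \<in> verts G \<and> {x, y} \<in> pair_orbit G {u, v} \<and>
      Max (edge_label lab G ` pair_orbit G {u, v}) = edge_label lab G {x, y}"
    if "u \<in> verts G" "v \<in> verts G" for u v
  proof -
    have "pair_orbit G {u, v} \<subseteq> Pow (verts G)" using that by (intro pair_orbit_subset_Pow) auto
    then have "finite (pair_orbit G {u, v})"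
      using G by (meson finite_Pow_iff finite_subset simple_graph_def)
    then have "Max (edge_label lab G ` pair_orbit G {u, v}) \<in> edge_label lab G ` pair_orbit G {u, v}"
      using pair_orbit_self by (intro Max_in) auto
    then obtain h where h: "graph_iso h G G"
      "Max (edge_label lab G ` pair_orbit G {u, v}) = edge_label lab G (h ` {u, v})"
      by (auto simp: pair_orbit_def)
    have "h u \<in> verts G" "h v \<in> verts G" using graph_iso_verts[OF h(1)] that by auto
    moreover have "{h u, h v} \<in> pair_orbit G {u, v}"
      using h(1) unfolding pair_orbit_def by (intro CollectI exI[of _ h]) simp
    ultimately show ?thesis using h(2) by auto
  qed
  have "Max (edge_label lab G ` pair_orbit G {a, b}) = Max (edge_label lab G ` pair_orbit G {c, d})"
    using eq by (simp add: edge_tuple_def)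
  then obtain e where "e \<in> pair_orbit G {a, b}" "e \<in> pair_orbit G {c, d}"
    using attained[OF ab] attained[OF cd] edge_label_determines_edge[OF lab G] by metis
  then have "pair_orbit G {c, d} = pair_orbit G {a, b}"
    using pair_orbit_eq ab cd by (metis empty_subsetI insert_subset)
  then show ?thesis using pair_orbit_self by blast
qed

section \<open>Canonical edges\<close>

text \<open>An automorphism may carry a pair to the representative of its orbit with the endpoints swapped,
  whence the symmetry of canonicity is needed.\<close>

lemma canonical_edge_commute: "canonical_edge lab G a b \<longleftrightarrow> canonical_edge lab G b a"
  unfolding canonical_edge_def by (simp add: edge_tuple_commute[of lab G a b] insert_commute[of a b])

lemma canonical_edge_iso:
  assumes lab: "canonical_labelling lab" and iso: "graph_iso f G H" and H: "simple_graph H"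
    and can: "canonical_edge lab G a b"
  shows "canonical_edge lab H (f a) (f b)"
proof -
  have r: "reducible G {a, b}" using can by (simp add: canonical_edge_def)
  note ab = reducible_edgeE[OF r]
  have r': "reducible H {f a, f b}" by (rule reducible_iso[OF iso r H])
  note H' = reducible_edgeE(5)[OF r']
  have "edge_tuple lab H c d \<le> edge_tuple lab H (f a) (f b)" if cd: "reducible H {c, d}" for c d
  proof -
    let ?g = "inv_into (verts G) f"
    have g: "graph_iso ?g H G" by (rule graph_iso_inv[OF iso])
    have "edge_tuple lab H c d = edge_tuple lab G (?g c) (?g d)"
      using edge_tuple_iso[OF lab H' ab(5) g] reducible_edgeE[OF cd] by simp
    also have "\<dots> \<le> edge_tuple lab G a b"
      using can reducible_iso[OF g cd uniquely_hamiltonian_simple[OF ab(5)]]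
      by (simp add: canonical_edge_def)
    also have "\<dots> = edge_tuple lab H (f a) (f b)"
      using edge_tuple_iso[OF lab ab(5) H' iso] ab by simp
    finally show ?thesis .
  qed
  with r' show ?thesis by (simp add: canonical_edge_def)
qed

text \<open>Transport the canonical edge of \<open>G\<close> to \<open>H\<close>: both edges of \<open>H\<close> are then of maximal tuple, so they
  have the same tuple and lie in one orbit.\<close>

lemma canonical_edge_unique:
  assumes lab: "canonical_labelling lab" and "isomorphic G H"
    and G: "canonical_edge lab G a b" and H: "canonical_edge lab H c d"
  obtains h where "graph_iso h G H" "h ` {a, b} = {c, d}"
proof -
  obtain f where f: "graph_iso f G H" using \<open>isomorphic G H\<close> by (auto simp: isomorphic_def)
  have r: "reducible G {a, b}" "reducible H {c, d}"
    using G H by (auto simp: canonical_edge_def)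
  note ab = reducible_edgeE[OF r(1)] and cd = reducible_edgeE[OF r(2)]
  note Hs = uniquely_hamiltonian_simple[OF cd(5)]
  have can: "canonical_edge lab H (f a) (f b)" by (rule canonical_edge_iso[OF lab f Hs G])
  then have "edge_tuple lab H (f a) (f b) = edge_tuple lab H c d"
    using H by (auto simp: canonical_edge_def intro: antisym)
  then have "{c, d} \<in> pair_orbit H {f a, f b}"
    using same_tuple_imp_same_orbit[OF lab Hs] ab cd graph_iso_verts[OF f] by blast
  then obtain k where k: "graph_iso k H H" "{c, d} = k ` f ` {a, b}"
    by (auto simp: pair_orbit_def)
  have "(k \<circ> f) ` {a, b} = {c, d}" using k(2) by simp
  then show ?thesis by (rule that[OF graph_iso_comp[OF f k(1)]])
qed

lemma canonical_edge_exists: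
  assumes "reducible G e"
  obtains a b where "canonical_edge lab G a b"
proof -
  have G: "simple_graph G" using assms by (simp add: reducible_def uniquely_hamiltonian_simple)
  let ?R = "{(a, b). reducible G {a, b}}"
  obtain a b where "e = {a, b}"
    using G assms by (auto simp: reducible_def elim: simple_graphE)
  then have "?R \<noteq> {}" using assms by blast
  moreover have "?R \<subseteq> verts G \<times> verts G" by (auto dest: reducible_edgeE)
  then have "finite ?R"
    using G by (meson finite_SigmaI finite_subset simple_graph_def)
  ultimately have "Max (case_prod (edge_tuple lab G) ` ?R) \<in> case_prod (edge_tuple lab G) ` ?R"
    by (intro Max_in) auto
  then obtain a b where ab: "reducible G {a, b}"
    "edge_tuple lab G a b = Max (case_prod (edge_tuple lab G) ` ?R)" by auto
  have "edge_tuple lab G c d \<le> edge_tuple lab G a b" if "reducible G {c, d}" for c d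
    unfolding ab(2) using that \<open>finite ?R\<close> by (intro Max_ge) auto
  then show ?thesis using ab(1) that by (auto simp: canonical_edge_def)
qed

lemma canonical_expansionD:
  assumes "canonical_expansion lab G a b"
  shows "a \<in> verts G" "b \<in> verts G" "a \<noteq> b" "{a, b} \<notin> edges G"
    "uniquely_hamiltonian G" "uniquely_hamiltonian (add_edge G {a, b})"
    "canonical_edge lab (add_edge G {a, b}) a b"
proof -
  show "a \<in> verts G" "b \<in> verts G" "a \<noteq> b" and new: "{a, b} \<notin> edges G"
    using assms by (auto simp: canonical_expansion_def nonadjacent_pairs_iff)
  show "uniquely_hamiltonian (add_edge G {a, b})"
    and "canonical_edge lab (add_edge G {a, b}) a b"
    using assms by (auto simp: canonical_expansion_def)
  then show "uniquely_hamiltonian G"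
    using remove_add_edge[OF new] by (simp add: canonical_edge_def reducible_def)
qed

lemma canonical_expansion_commute:
  "canonical_expansion lab G a b \<longleftrightarrow> canonical_expansion lab G b a"
  unfolding canonical_expansion_def
  by (simp add: canonical_edge_commute[of lab _ a b] insert_commute[of a b])

lemma canonical_expansion_iso:
  assumes lab: "canonical_labelling lab" and iso: "graph_iso f G H" and H: "simple_graph H"
    and can: "canonical_expansion lab G a b"
  shows "canonical_expansion lab H (f a) (f b)"
proof -
  note ab = canonical_expansionD[OF can]
  have non: "{f a, f b} \<in> nonadjacent_pairs H"
    using nonadjacent_pairs_iso[OF iso] can by (simp add: canonical_expansion_def)
  then have s: "simple_graph (add_edge H {f a, f b})"
    using H by (auto simp: simple_graph_def add_edge_def nonadjacent_pairs_iff)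
  have iso': "graph_iso f (add_edge G {a, b}) (add_edge H {f a, f b})"
    using graph_iso_add_edge[OF iso] ab by simp
  show ?thesis
    using non uniquely_hamiltonian_iso[OF iso' ab(6) s] canonical_edge_iso[OF lab iso' s ab(7)]
    by (simp add: canonical_expansion_def)
qed

lemma canonical_expansion_orbit:
  assumes lab: "canonical_labelling lab" and can: "canonical_expansion lab G a b"
    and iso: "graph_iso f G H" and H: "simple_graph H" and cd: "{c, d} = f ` {a, b}"
  shows "canonical_expansion lab H c d"
    and "isomorphic (add_edge G {a, b}) (add_edge H {c, d})"
proof -
  have cd: "{c, d} = {f a, f b}" using cd by simp
  show "canonical_expansion lab H c d"
    using canonical_expansion_iso[OF lab iso H can] canonical_expansion_commute cd
    by (metis doubleton_eq_iff)
  show "isomorphic (add_edge G {a, b}) (add_edge H {c, d})"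
    unfolding isomorphic_def cd using graph_iso_add_edge[OF iso] canonical_expansionD[OF can] by blast
qed

text \<open>The parent of a graph is well defined up to isomorphism, and so is the orbit of the pair whose
  insertion leads back to it: an isomorphism that matches the two canonical edges restricts to the
  graphs without them.\<close>

lemma canonical_expansion_unique:
  assumes lab: "canonical_labelling lab"
    and G: "canonical_expansion lab G a b" and H: "canonical_expansion lab H c d"
    and "isomorphic (add_edge G {a, b}) (add_edge H {c, d})"
  obtains h where "graph_iso h G H" "h ` {a, b} = {c, d}"
proof -
  note ab = canonical_expansionD[OF G] and cd = canonical_expansionD[OF H]
  obtain h where h: "graph_iso h (add_edge G {a, b}) (add_edge H {c, d})"
    and im: "h ` {a, b} = {c, d}"
    using canonical_edge_unique[OF lab assms(4) ab(7) cd(7)] .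
  have "graph_iso h (remove_edge (add_edge G {a, b}) {a, b})
      (remove_edge (add_edge H {c, d}) {h a, h b})"
    using graph_iso_remove_edge[OF h] ab by simp
  then have "graph_iso h G H" using im ab cd by (simp add: remove_add_edge)
  with im show ?thesis by (rule that[rotated])
qed

section \<open>Canonical ancestry\<close>

text \<open>Reachability by canonical expansions up to isomorphism.  Allowing an isomorphism after every step
  makes the relation independent of the representatives that an execution picks.\<close>

inductive canonical_ancestor :: "('a graph \<Rightarrow> 'a \<Rightarrow> nat) \<Rightarrow> 'a graph \<Rightarrow> 'a graph \<Rightarrow> bool"
  for lab where
  ancestor_iso: "\<lbrakk>uniquely_hamiltonian G; uniquely_hamiltonian H; isomorphic G H\<rbrakk> \<Longrightarrow>
    canonical_ancestor lab G H"
| ancestor_step: "\<lbrakk>canonical_ancestor lab G K; canonical_expansion lab K a b;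
    uniquely_hamiltonian H; isomorphic (add_edge K {a, b}) H\<rbrakk> \<Longrightarrow> canonical_ancestor lab G H"

lemma isomorphic_card_edges:
  "\<lbrakk>isomorphic G H; uniquely_hamiltonian G; uniquely_hamiltonian H\<rbrakk> \<Longrightarrow>
     card (edges G) = card (edges H)"
  unfolding isomorphic_def by (blast intro: graph_iso_card_edges uniquely_hamiltonian_simple)

lemma card_edges_canonical_expansion:
  assumes "canonical_expansion lab K a b" "uniquely_hamiltonian H"
    "isomorphic (add_edge K {a, b}) H"
  shows "card (edges H) = Suc (card (edges K))"
proof -
  note ab = canonical_expansionD[OF assms(1)]
  have "card (edges (add_edge K {a, b})) = card (edges H)"
    by (rule isomorphic_card_edges[OF assms(3) ab(6) assms(2)])
  then show ?thesis
    using card_edges_add_edge[OF uniquely_hamiltonian_simple[OF ab(5)] ab(4)] by simp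
qed

lemma ancestor_card_edges_le:
  "canonical_ancestor lab G H \<Longrightarrow> card (edges G) \<le> card (edges H)"
proof (induction rule: canonical_ancestor.induct)
  case (ancestor_iso G H)
  then show ?case using isomorphic_card_edges by fastforce
next
  case (ancestor_step G K a b H)
  then show ?case using card_edges_canonical_expansion by fastforce
qed

lemma ancestor_iso_left:
  assumes "canonical_ancestor lab G H" "uniquely_hamiltonian G'" "isomorphic G G'"
  shows "canonical_ancestor lab G' H"
  using assms
proof (induction rule: canonical_ancestor.induct)
  case (ancestor_iso G H)
  then show ?case by (meson canonical_ancestor.ancestor_iso isomorphic_sym isomorphic_trans)
next
  case (ancestor_step G K a b H)
  then show ?case by (blast intro: canonical_ancestor.ancestor_step)
qed

lemma ancestor_of_expansion:
  assumes "canonical_ancestor lab G' H" "canonical_expansion lab G a b" "G' = add_edge G {a, b}"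
  shows "canonical_ancestor lab G H"
  using assms
proof (induction rule: canonical_ancestor.induct)
  case (ancestor_iso G' H)
  have "uniquely_hamiltonian G" using ancestor_iso by (auto dest: canonical_expansionD)
  then have "canonical_ancestor lab G G"
    by (simp add: canonical_ancestor.ancestor_iso isomorphic_refl)
  with ancestor_iso show ?case by (blast intro: canonical_ancestor.ancestor_step)
next
  case (ancestor_step G' K a b H)
  then show ?case by (blast intro: canonical_ancestor.ancestor_step)
qed

text \<open>The definition appends expansions at the end of a chain, whereas the procedure unfolds them from
  its start.  If \<open>G\<close> is isomorphic to the graph \<open>K\<close> that is expanded, the expansion of \<open>K\<close> is
  transported to \<open>G\<close>.\<close>

lemma ancestor_first_step:
  assumes lab: "canonical_labelling lab" and "canonical_ancestor lab G H" "\<not> isomorphic G H"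
    "uniquely_hamiltonian G"
  shows "\<exists>a b. canonical_expansion lab G a b \<and> canonical_ancestor lab (add_edge G {a, b}) H"
  using assms(2-)
proof (induction rule: canonical_ancestor.induct)
  case (ancestor_iso G H)
  then show ?case by simp
next
  case (ancestor_step G K a b H)
  show ?case
  proof (cases "isomorphic G K")
    case True
    then obtain f where f: "graph_iso f K G" using isomorphic_sym isomorphic_def by blast
    have G: "simple_graph G" by (rule uniquely_hamiltonian_simple) fact
    have "canonical_expansion lab G (f a) (f b)"
      and "isomorphic (add_edge K {a, b}) (add_edge G {f a, f b})"
      using canonical_expansion_orbit[OF lab ancestor_step(2) f G, of "f a" "f b"] by auto
    then show ?thesis using ancestor_step
      by (meson canonical_ancestor.ancestor_iso canonical_expansionD(6) isomorphic_sym isomorphic_trans)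
  next
    case False
    then show ?thesis using ancestor_step by (meson canonical_ancestor.ancestor_step)
  qed
qed

text \<open>Both chains are followed backwards from the common end.  As every step adds exactly one edge, the
  edge counts force the two chains to have the same length, and their last steps start at
  isomorphic graphs because the parent is unique.\<close>

lemma ancestor_unique:
  assumes lab: "canonical_labelling lab" and "canonical_ancestor lab A H"
    "canonical_ancestor lab B H'" "isomorphic H H'" "card (edges A) = card (edges B)"
  shows "isomorphic A B"
  using assms(2-)
proof (induction arbitrary: H' rule: canonical_ancestor.induct)
  case (ancestor_iso A H)
  from ancestor_iso(4) show ?case
  proof cases
    case ancestor_iso
    then show ?thesis
      using \<open>isomorphic A H\<close> \<open>isomorphic H H'\<close> by (meson isomorphic_sym isomorphic_trans)
  next
    case (ancestor_step K a b)
    have "card (edges A) = card (edges H')"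
      using \<open>isomorphic A H\<close> \<open>isomorphic H H'\<close> \<open>uniquely_hamiltonian A\<close> ancestor_step
      by (meson isomorphic_card_edges isomorphic_trans)
    with ancestor_step \<open>card (edges A) = card (edges B)\<close> show ?thesis
      using ancestor_card_edges_le card_edges_canonical_expansion by fastforce
  qed
next
  case (ancestor_step A K a b H)
  note step = ancestor_step
  from step(6) show ?case
  proof cases
    case ancestor_iso
    have "card (edges B) = card (edges H)"
      using ancestor_iso step by (metis isomorphic_card_edges)
    moreover have "card (edges H) = Suc (card (edges K))"
      using step by (meson card_edges_canonical_expansion)
    ultimately show ?thesis using ancestor_card_edges_le[OF step(1)] step(8) by simp
  next
    case (ancestor_step K' c d)
    have "isomorphic (add_edge K {a, b}) (add_edge K' {c, d})"
      using step ancestor_step by (meson isomorphic_sym isomorphic_trans)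
    then have "isomorphic K K'"
      using canonical_expansion_unique[OF lab step(2) ancestor_step(2)] isomorphic_def by metis
    then show ?thesis using step ancestor_step by blast
  qed
qed

text \<open>Repeatedly deleting canonical edges ends at a uniquely hamiltonian graph without reducible edges,
  which is a cycle.  Each deletion is undone by a canonical expansion.\<close>

lemma cycle_is_ancestor:
  assumes lab: "canonical_labelling lab" and C: "is_cycle C"
    and "uniquely_hamiltonian H" "card (verts H) = card (verts C)"
  shows "canonical_ancestor lab C H"
  using assms(3,4)
proof (induction "card (edges H)" arbitrary: H rule: less_induct)
  case less
  show ?case
  proof (cases "\<exists>e. reducible H e")
    case False
    then have "isomorphic C H"
      using irreducible_imp_cycle[OF less(2)] cycles_isomorphic[OF C] less(3) by metis
    then show ?thesis
      using cycle_uniquely_hamiltonian[OF C] less(2) by (blast intro: ancestor_iso)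
  next
    case True
    then obtain a b where can: "canonical_edge lab H a b" using canonical_edge_exists by metis
    then have "reducible H {a, b}" by (simp add: canonical_edge_def)
    note ab = reducible_edgeE[OF this]
    let ?K = "remove_edge H {a, b}"
    have add: "add_edge ?K {a, b} = H" by (rule add_remove_edge[OF ab(4)])
    have exp: "canonical_expansion lab ?K a b"
      using ab can add by (simp add: canonical_expansion_def nonadjacent_pairs_iff)
        (simp add: remove_edge_def)
    have "card (edges H) = Suc (card (edges ?K))"
      using card_edges_canonical_expansion[OF exp less(2)] isomorphic_refl add by metis
    then have "canonical_ancestor lab C ?K" using less ab by simp
    then show ?thesis using exp less(2) isomorphic_refl add by (metis ancestor_step)
  qed
qed

section \<open>Executions of the procedure\<close>

text \<open>Orbits are equivalence classes, so a pair chosen from one orbit lies in no other orbit.\<close>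

lemma orbit_representatives_exist:
  assumes "simple_graph G"
  shows "\<exists>ps. orbit_representatives G ps"
proof -
  let ?O = "pair_orbit G ` nonadjacent_pairs G"
  have "nonadjacent_pairs G \<subseteq> Pow (verts G)" by (auto simp: nonadjacent_pairs_def)
  then have fin: "finite ?O"
    using assms by (meson finite_Pow_iff finite_imageI finite_subset simple_graph_def)
  have "\<exists>p. {fst p, snd p} \<in> nonadjacent_pairs G \<and> orb = pair_orbit G {fst p, snd p}" if "orb \<in> ?O" for orb
    using that by (auto simp: nonadjacent_pairs_def)
  then obtain r where r: "\<And>orb. orb \<in> ?O \<Longrightarrow> {fst (r orb), snd (r orb)} \<in> nonadjacent_pairs G"
    "\<And>orb. orb \<in> ?O \<Longrightarrow> orb = pair_orbit G {fst (r orb), snd (r orb)}" by metis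
  obtain ps where ps: "distinct ps" "set ps = r ` ?O"
    using finite_distinct_list[OF finite_imageI[OF fin]] by metis
  have "\<exists>!(a, b). (a, b) \<in> set ps \<and> {a, b} \<in> orb" if orb: "orb \<in> ?O" for orb
  proof (rule ex1I[of _ "r orb"])
    show "case r orb of (a, b) \<Rightarrow> (a, b) \<in> set ps \<and> {a, b} \<in> orb"
      using r(2)[OF orb] pair_orbit_self[of "{fst (r orb), snd (r orb)}" G] orb ps
      by (auto simp: split_beta)
  next
    fix p assume "case p of (a, b) \<Rightarrow> (a, b) \<in> set ps \<and> {a, b} \<in> orb"
    then have p: "p \<in> set ps" "{fst p, snd p} \<in> orb" by (auto simp: split_beta)
    then obtain orb' where orb': "orb' \<in> ?O" "p = r orb'" using ps by blast
    have "{fst (r orb), snd (r orb)} \<subseteq> verts G"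
      using r(1)[OF orb] by (simp add: nonadjacent_pairs_iff)
    then have "orb' = orb" using pair_orbit_eq p(2) r(2)[OF orb] r(2)[OF orb'(1)] orb'(2) by metis
    then show "p = r orb" using orb' by simp
  qed
  then have "orbit_representatives G ps"
    unfolding orbit_representatives_def using ps r(1) by (auto simp: split_beta)
  then show ?thesis ..
qed

text \<open>Every recursive call is made on a graph with fewer non-adjacent pairs.\<close>

lemma construct_terminates:
  assumes "uniquely_hamiltonian G"
  shows "\<exists>out. construct lab G out"
  using assms
proof (induction "card (nonadjacent_pairs G)" arbitrary: G rule: less_induct)
  case less
  note G = uniquely_hamiltonian_simple[OF less(2)]
  have rec: "\<exists>out. construct lab (add_edge G {a, b}) out" if "canonical_expansion lab G a b" for a b
  proof (rule less(1))
    have "{a, b} \<in> nonadjacent_pairs G" using that by (simp add: canonical_expansion_def)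
    moreover have "nonadjacent_pairs (add_edge G {a, b}) = nonadjacent_pairs G - {{a, b}}"
      by (auto simp: nonadjacent_pairs_def add_edge_def)
    moreover have "nonadjacent_pairs G \<subseteq> Pow (verts G)" by (auto simp: nonadjacent_pairs_def)
    then have "finite (nonadjacent_pairs G)"
      using G by (meson finite_Pow_iff finite_subset simple_graph_def)
    ultimately show "card (nonadjacent_pairs (add_edge G {a, b})) < card (nonadjacent_pairs G)"
      by (simp only: card_Diff1_less)
    show "uniquely_hamiltonian (add_edge G {a, b})" using that by (rule canonical_expansionD)
  qed
  have "\<exists>out. process lab G ps out" for ps
  proof (induction ps)
    case Nil
    then show ?case using process_done by blast
  next
    case (Cons p ps)
    obtain a b where p: "p = (a, b)" by fastforce
    then show ?case
      using Cons rec[of a b] canonical_expansionD(6)[of lab G a b]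
        process_call[of G a b lab] process_skip[of G a b lab] by blast
  qed
  then show ?case using orbit_representatives_exist[OF G] construct_process.construct by blast
qed

lemma construct_output:
  "construct lab G out \<Longrightarrow> uniquely_hamiltonian G \<Longrightarrow>
     \<forall>K\<in>set out. uniquely_hamiltonian K \<and> verts K = verts G"
  "process lab G ps out \<Longrightarrow> \<forall>K\<in>set out. uniquely_hamiltonian K \<and> verts K = verts G"
  by (induction rule: construct_process.inducts) auto

text \<open>The iterations of the loop on \<open>G\<close> whose recursive call outputs a copy of \<open>H\<close>.\<close>

definition leads_to :: "('a graph \<Rightarrow> 'a \<Rightarrow> nat) \<Rightarrow> 'a graph \<Rightarrow> 'a graph \<Rightarrow> 'a \<times> 'a \<Rightarrow> bool" where
  "leads_to lab G H = (\<lambda>(a, b).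
     canonical_expansion lab G a b \<and> canonical_ancestor lab (add_edge G {a, b}) H)"

text \<open>If \<open>G\<close> is isomorphic to \<open>H\<close>, no iteration can lead to \<open>H\<close>, since its graph already has more edges
  than \<open>H\<close>.  If \<open>G\<close> is a proper ancestor, the pairs that lead to \<open>H\<close> form exactly one orbit, which
  is represented once.\<close>

lemma count_representatives:
  assumes lab: "canonical_labelling lab" and G: "uniquely_hamiltonian G"
    and ps: "orbit_representatives G ps"
  shows "length (filter (leads_to lab G H) ps) =
    of_bool (canonical_ancestor lab G H \<and> \<not> isomorphic G H)"
proof (cases "canonical_ancestor lab G H \<and> \<not> isomorphic G H")
  case True
  note Gs = uniquely_hamiltonian_simple[OF G]
  \<comment> \<open>The pair need not be among the representatives; the representative of its orbit replaces it.\<close>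
  obtain a b where ab: "canonical_expansion lab G a b" "canonical_ancestor lab (add_edge G {a, b}) H"
    using ancestor_first_step[OF lab] True G by blast
  let ?orb = "pair_orbit G {a, b}"
  have "?orb \<in> pair_orbit G ` nonadjacent_pairs G"
    using ab(1) by (auto simp: canonical_expansion_def)
  then have ex1: "\<exists>!(c, d). (c, d) \<in> set ps \<and> {c, d} \<in> ?orb"
    using ps unfolding orbit_representatives_def by (elim conjE) (rule bspec)
  then obtain c d where cd: "(c, d) \<in> set ps" "{c, d} \<in> ?orb" by auto
  then obtain h where h: "graph_iso h G G" "{c, d} = h ` {a, b}" by (auto simp: pair_orbit_def)
  have "leads_to lab G H (c, d)"
    using canonical_expansion_orbit[OF lab ab(1) h(1) Gs h(2)] ab(2)
    by (auto simp: leads_to_def intro: ancestor_iso_left canonical_expansionD(6))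
  moreover have "p = (c, d)" if "p \<in> set ps" "leads_to lab G H p" for p
  proof -
    obtain u v where p: "p = (u, v)" by fastforce
    then have uv: "canonical_expansion lab G u v" "canonical_ancestor lab (add_edge G {u, v}) H"
      using that(2) by (auto simp: leads_to_def)
    have "card (edges (add_edge G {a, b})) = card (edges (add_edge G {u, v}))"
      using ab(1) uv(1) Gs by (simp add: card_edges_add_edge canonical_expansionD(4))
    then have "isomorphic (add_edge G {a, b}) (add_edge G {u, v})"
      using ancestor_unique[OF lab ab(2) uv(2) isomorphic_refl] by blast
    then obtain k where "graph_iso k G G" "k ` {a, b} = {u, v}"
      using canonical_expansion_unique[OF lab ab(1) uv(1)] by blast
    then have "{u, v} \<in> ?orb" unfolding pair_orbit_def by blast
    then show ?thesis using ex1 cd that(1) p by auto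
  qed
  ultimately have "{p \<in> set ps. leads_to lab G H p} = {(c, d)}" using cd by blast
  moreover have "distinct (filter (leads_to lab G H) ps)"
    using ps by (simp add: orbit_representatives_def)
  ultimately have "length (filter (leads_to lab G H) ps) = 1"
    using distinct_card[of "filter (leads_to lab G H) ps"] by simp
  then show ?thesis using True by simp
next
  case False
  have "\<not> leads_to lab G H p" for p
  proof
    assume "leads_to lab G H p"
    then obtain a b where ab: "canonical_expansion lab G a b"
      "canonical_ancestor lab (add_edge G {a, b}) H"
      by (cases p) (auto simp: leads_to_def)
    have H: "uniquely_hamiltonian H" using ab(2) by cases
    have "isomorphic G H" using False ancestor_of_expansion[OF ab(2,1)] by blast
    then have "card (edges G) = card (edges H)" using isomorphic_card_edges G H by blast
    then show False
      using ancestor_card_edges_le[OF ab(2)] canonical_expansionD[OF ab(1)]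
      by (simp add: card_edges_add_edge uniquely_hamiltonian_simple)
  qed
  then show ?thesis using False by simp
qed

text \<open>The output \<open>G\<close> itself accounts for the case that \<open>G\<close> is isomorphic to \<open>H\<close>, and the loop for the case
  of a proper ancestor.  Skipped iterations are exactly those that are not canonical expansions, so
  they contribute to neither side.\<close>

lemma construct_count:
  assumes lab: "canonical_labelling lab" and H: "uniquely_hamiltonian H"
  shows "construct lab G out \<Longrightarrow> uniquely_hamiltonian G \<Longrightarrow>
      length (filter (\<lambda>K. isomorphic K H) out) = of_bool (canonical_ancestor lab G H)"
    and "process lab G ps out \<Longrightarrow>
      length (filter (\<lambda>K. isomorphic K H) out) = length (filter (leads_to lab G H) ps)"
proof (induction rule: construct_process.inducts)
  case (construct G ps out)
  moreover have "isomorphic G H \<Longrightarrow> canonical_ancestor lab G H"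
    using construct.prems H by (rule ancestor_iso)
  ultimately show ?case using count_representatives[OF lab] by auto
qed (auto simp: leads_to_def dest: canonical_expansionD(6))

lemma filter_length_1_imp_Ex1:
  assumes "length (filter P xs) = 1"
  shows "\<exists>!i. i < length xs \<and> P (xs ! i)"
proof -
  have "card {i. i < length xs \<and> P (xs ! i)} = 1"
    using assms by (simp add: length_filter_conv_card)
  then obtain i where i: "{i. i < length xs \<and> P (xs ! i)} = {i}" by (rule card_1_singletonE)
  have "j < length xs \<and> P (xs ! j) \<longleftrightarrow> j = i" for j
    using i unfolding set_eq_iff mem_Collect_eq singleton_iff by (rule spec)
  then show ?thesis by (simp only: ex1_eq simp_thms)
qed

theorem theorem2p1:
  fixes n :: nat and C :: "'a graph" and lab :: "'a graph \<Rightarrow> 'a \<Rightarrow> nat"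
  assumes "n \<ge> 3"
    and "canonical_labelling lab"
    and "is_cycle C" and "card (verts C) = n"
  shows "(\<exists>out. construct lab C out) \<and>
    (\<forall>out. construct lab C out \<longrightarrow>
      (\<forall>G \<in> set out. uniquely_hamiltonian G \<and> card (verts G) = n) \<and>
      (\<forall>H :: 'b graph. uniquely_hamiltonian H \<and> card (verts H) = n \<longrightarrow>
        (\<exists>!i. i < length out \<and> isomorphic (out ! i) H)))"
proof (intro conjI allI impI ballI; (elim conjE)?)
  note C = cycle_uniquely_hamiltonian[OF assms(3)]
  show "\<exists>out. construct lab C out" by (rule construct_terminates[OF C])
  fix out assume out: "construct lab C out"
  show "uniquely_hamiltonian G" "card (verts G) = n" if "G \<in> set out" for G
    using construct_output(1)[OF out C] that assms(4) by auto
  fix H :: "'b graph" assume H: "uniquely_hamiltonian H" "card (verts H) = n"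
  have "finite (verts C)" using C by (simp add: uniquely_hamiltonian_def simple_graph_def)
  then obtain H' :: "'a graph" where H': "uniquely_hamiltonian H'" "verts H' = verts C"
    and iso: "isomorphic H' H"
    using isomorphic_image_graph[OF H(1)] H(2) assms(4) by metis
  have "canonical_ancestor lab C H'" using cycle_is_ancestor assms H' by metis
  then have "length (filter (\<lambda>K. isomorphic K H') out) = 1"
    using construct_count(1)[OF assms(2) H'(1) out C] by simp
  then have "\<exists>!i. i < length out \<and> isomorphic (out ! i) H'" by (rule filter_length_1_imp_Ex1)
  moreover have "isomorphic K H \<longleftrightarrow> isomorphic K H'" for K :: "'a graph"
    using iso by (meson isomorphic_sym isomorphic_trans)
  ultimately show "\<exists>!i. i < length out \<and> isomorphic (out ! i) H" by simp
qed

end
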